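(* Let $k\in[0,3)$ and $q,q_1,q_2\in\mathbb{R}$. (i) When $k\in[23/17,3)$, the inequality $$SB(b,a)>\left(\left(1-\tfrac k3\right)a^q+\tfrac k3b^q\right)^{1/(kq)}a^{1-1/k}$$ holds for all $b>a>0$ if and only if $q\le\frac{8}{5(3-k)}$. (ii) When $k\in[0,1]$, the double inequality $$\left(\left(1-\tfrac k3\right)a^{q_1}+\tfrac k3b^{q_1}\right)^{1/(kq_1)}a^{1-1/k}<SB(b,a)<\left(\left(1-\tfrac k3\right)a^{q_2}+\tfrac k3b^{q_2}\right)^{1/(kq_2)}a^{1-1/k}$$ holds for all $b>a>0$ if and only if $q_1\le0$ and $q_2\ge\frac{8}{5(3-k)}$.
   Context: For $b>a>0$, $SB(b,a)=\dfrac{\sqrt{b^2-a^2}}{\operatorname{arccosh}(b/a)}$ is the Schwab–Borchardt mean. Convention: for zero parameters, the expression $\left(\left(1-\frac k3\right)a^q+\frac k3b^q\right)^{1/(kq)}a^{1-1/k}$ is understood as the corresponding limit: with $t=b/a$ it means $a\exp\frac{t^q-1}{3q}$ if $k=0$, $q\neq0$, and $a\,t^{1/3}$ if $q=0$. *)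

theory Defs
  imports Complex_Main
begin

definition SB :: "real \<Rightarrow> real \<Rightarrow> real" where
  "SB b a = sqrt (b\<^sup>2 - a\<^sup>2) / arcosh (b / a)"

text \<open>The first two branches are the limits of the third one as the parameters tend to zero
  (with \<open>t = b / a\<close>): \<open>a * t powr (1/3)\<close> for \<open>q = 0\<close>, any \<open>k\<close>, and
  \<open>a * exp ((t powr q - 1) / (3 * q))\<close> for \<open>k = 0\<close>, \<open>q \<noteq> 0\<close>.\<close>

definition H :: "real \<Rightarrow> real \<Rightarrow> real \<Rightarrow> real \<Rightarrow> real" where
  "H k q b a =
    (if q = 0 then a * (b / a) powr (1 / 3)
     else if k = 0 then a * exp (((b / a) powr q - 1) / (3 * q))
     else ((1 - k / 3) * a powr q + k / 3 * b powr q) powr (1 / (k * q)) * a powr (1 - 1 / k))"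

end

theory Submission
  imports Defs "HOL-Real_Asymp.Real_Asymp"
begin

text \<open>
  With \<open>b / a = cosh x\<close> one compares \<open>ln (sinh x / x)\<close> with the logarithm \<open>J k q v\<close> of the normalised
  mean, \<open>v = ln (cosh x)\<close>. The derivative \<open>1 / (3 * ((1 - k / 3) * exp (- q v) + k / 3))\<close> of
  \<open>J k q\<close> shows that \<open>J\<close> increases with \<open>q\<close>, and that along the critical curve
  \<open>q = 8 / (5 * (3 - k))\<close> it decreases with \<open>k\<close>. So the sharp inequalities follow from the two
  extremal ones, at \<open>(k, q) = (1, 4 / 5)\<close> from above and at \<open>(23 / 17, 34 / 35)\<close> from below. Each of
  these is the sign of a combination of hyperbolic functions whose power series has coefficients of
  constant sign; \<open>23 / 17\<close> is the value of \<open>k\<close> at which the coefficient of \<open>x ^ 8\<close> vanishes.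
  Since \<open>J k q v = v / 3 + q * (3 - k) / 18 * v\<^sup>2 + \<dots>\<close>, both extremal means have the same second
  order term, which forces the critical value of \<open>q\<close>.
\<close>

section \<open>Strict bounds from one-sided limits at 0\<close>

text \<open>The intermediate value \<open>f (x / 2)\<close> restores the strictness that passing to
  the limit loses. A limit replaces the value at 0 because the functions concerned involve
  \<open>ln x\<close> or quotients of the form 0/0.\<close>

lemma gt_right_limit:
  fixes f f' :: "real \<Rightarrow> real"
  assumes lim: "(f \<longlongrightarrow> l) (at_right 0)"
    and deriv: "\<And>x. 0 < x \<Longrightarrow> (f has_real_derivative f' x) (at x)"
    and pos: "\<And>x. 0 < x \<Longrightarrow> 0 < f' x"
    and "0 < x"
  shows "l < f x"
proof -
  have incr: "f y < f z" if "0 < y" "y < z" for y z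
    by (rule DERIV_pos_imp_increasing[OF \<open>y < z\<close>])
      (use that deriv pos in \<open>meson less_le_trans\<close>)
  have "eventually (\<lambda>y. f y \<le> f (x / 2)) (at_right 0)"
    by (rule eventually_mono[OF eventually_at_right_real[of 0 "x / 2"]])
      (use \<open>0 < x\<close> in \<open>auto intro!: less_imp_le[OF incr]\<close>)
  then have "l \<le> f (x / 2)"
    by (rule tendsto_upperbound[OF lim]) simp
  also have "\<dots> < f x"
    using \<open>0 < x\<close> by (intro incr) auto
  finally show ?thesis .
qed

lemma lt_right_limit:
  fixes f f' :: "real \<Rightarrow> real"
  assumes lim: "(f \<longlongrightarrow> l) (at_right 0)"
    and deriv: "\<And>x. 0 < x \<Longrightarrow> (f has_real_derivative f' x) (at x)"
    and neg: "\<And>x. 0 < x \<Longrightarrow> f' x < 0"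
    and "0 < x"
  shows "f x < l"
  using gt_right_limit[of "\<lambda>x. - f x" "- l" "\<lambda>x. - f' x" x] assms
  by (auto intro: tendsto_minus DERIV_minus)

section \<open>Power series of hyperbolic functions and triple-argument formulas\<close>

text \<open>The index is the exponent itself, with zero odd terms, so that linear combinations of
  such series can be formed termwise.\<close>

lemma sums_even_cosh:
  "(\<lambda>n. if even n then y ^ n / fact n else 0) sums cosh (y::real)"
  using cosh_converges[of y] by (simp add: scaleR_conv_of_real divide_inverse mult.commute if_distrib cong: if_cong)

lemma sums_even_mult_sinh:
  "(\<lambda>n. if even n then real n * (y ^ n / fact n) else 0) sums (y * sinh y)"
proof -
  have eq: "(\<lambda>n. y * (if even n then 0 else y ^ n / fact n)) =
      (\<lambda>n. if even (n + 1) then real (n + 1) * (y ^ (n + 1) / fact (n + 1)) else 0)"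
    by (auto simp: fun_eq_iff divide_simps)
  have "(\<lambda>n. y * (if even n then 0 else y ^ n / fact n)) sums (y * sinh y)"
    using sinh_converges[of y]
    by (intro sums_mult) (simp add: scaleR_conv_of_real divide_inverse mult.commute if_distrib cong: if_cong)
  then show ?thesis
    \<comment> \<open>Multiplying by \<open>y\<close> shifts the index by one; the missing term at 0
      vanishes because of the factor \<open>n\<close>.\<close>
    unfolding eq by (subst (asm) sums_iff_shift) simp
qed

lemma sums_even_square_mult_cosh:
  "(\<lambda>n. if even n then real n * (real n - 1) * (y ^ n / fact n) else 0) sums (y\<^sup>2 * cosh y)"
proof -
  have eq: "(\<lambda>n. y\<^sup>2 * (if even n then y ^ n / fact n else 0)) =
      (\<lambda>n. if even (n + 2) then real (n + 2) * (real (n + 2) - 1) * (y ^ (n + 2) / fact (n + 2)) else 0)"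
    by (auto simp: fun_eq_iff divide_simps power2_eq_square) 
  have "(\<lambda>n. y\<^sup>2 * (if even n then y ^ n / fact n else 0)) sums (y\<^sup>2 * cosh y)"
    by (intro sums_mult sums_even_cosh)
  then show ?thesis
    unfolding eq by (subst (asm) sums_iff_shift) (simp add: numeral_2_eq_2)
qed

lemma cosh_triple: "cosh (3 * x) = 4 * cosh x ^ 3 - 3 * cosh (x::real)"
proof -
  have "cosh (3 * x) = cosh (2 * x + x)" by (simp add: algebra_simps)
  then show ?thesis
    using hyperbolic_pythagoras[of x]
    unfolding cosh_add sinh_double cosh_double by algebra
qed

lemma sinh_triple: "sinh (3 * x) = 4 * cosh x ^ 2 * sinh x - sinh (x::real)"
proof -
  have "sinh (3 * x) = sinh (2 * x + x)" by (simp add: algebra_simps)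
  then show ?thesis
    using hyperbolic_pythagoras[of x]
    unfolding sinh_add sinh_double cosh_double by algebra
qed


section \<open>Two inequalities between hyperbolic functions\<close>

lemma sums_pos:
  fixes f :: "nat \<Rightarrow> real"
  assumes "f sums l" "\<And>n. 0 \<le> f n" "0 < f m"
  shows "0 < l"
  using suminf_pos2[of f m] assms by (auto simp: sums_iff)

lemma three_power_ge: "7 \<le> n \<Longrightarrow> 27 * real n ^ 2 \<le> 3 ^ n"
proof (induction n rule: dec_induct)
  case (step n)
  have "7 * real n \<le> real n * real n"
    using step.hyps by (intro mult_right_mono) auto
  moreover have "7 \<le> real n"
    using step.hyps by simp
  moreover have "81 * (real n * real n) \<le> 3 * 3 ^ n"
    using step.IH by (simp add: power2_eq_square)
  ultimately have "27 * ((1 + real n) * (1 + real n)) \<le> 3 * 3 ^ n"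
    unfolding distrib_left distrib_right by linarith
  then show ?case
    by (simp add: power2_eq_square)
qed simp

lemma even_less_10: "even (n::nat) \<Longrightarrow> n < 10 \<Longrightarrow> n \<in> {0, 2, 4, 6, 8}"
  unfolding insert_iff empty_iff by presburger

text \<open>The coefficient \<open>w n\<close> of \<open>x ^ n / fact n\<close> vanishes for n = 0,
  2, 4, 6. From n = 8 on, \<open>real n / 3\<close> exceeds 9/4 and every summand is
  nonnegative.\<close>

lemma hyperbolic_ineq_upper:
  fixes x :: real
  assumes "0 < x"
  shows "9 / 4 * (cosh (3 * x) - cosh x) < x * sinh (3 * x) + 6 * x\<^sup>2 * cosh x"
proof -
  define w :: "nat \<Rightarrow> real" where
    "w n = (real n / 3 - 9 / 4) * 3 ^ n + 9 / 4 + 6 * real n * (real n - 1)" for n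
  have sums: "(\<lambda>n. if even n then w n * (x ^ n / fact n) else 0) sums
    (1 / 3 * (3 * x * sinh (3 * x)) + 6 * (x\<^sup>2 * cosh x) - 9 / 4 * (cosh (3 * x) - cosh x))"
    by (rule sums_cong[THEN iffD1, rotated, OF sums_diff[OF sums_add[OF
            sums_mult[OF sums_even_mult_sinh] sums_mult[OF sums_even_square_mult_cosh]]
          sums_mult[OF sums_diff[OF sums_even_cosh sums_even_cosh]]]])
      (simp add: w_def power_mult_distrib field_simps)
  have w: "0 \<le> w n" if "even n" for n
  proof (cases "n < 8")
    case True
    then show ?thesis
      using even_less_10[OF that] by (auto simp: w_def)
  next
    case False
    then have "0 \<le> (real n / 3 - 9 / 4) * 3 ^ n" "0 \<le> 6 * real n * (real n - 1)"
      by auto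
    then show ?thesis
      unfolding w_def by linarith
  qed
  have "0 < 1 / 3 * (3 * x * sinh (3 * x)) + 6 * (x\<^sup>2 * cosh x) - 9 / 4 * (cosh (3 * x) - cosh x)"
  proof (rule sums_pos[OF sums, where m = 8])
    show "0 \<le> (if even n then w n * (x ^ n / fact n) else 0)" for n
      using w \<open>0 < x\<close> by simp
    show "0 < (if even (8::nat) then w 8 * (x ^ 8 / fact 8) else 0)"
      using \<open>0 < x\<close> by (simp add: w_def)
  qed
  then show ?thesis
    by simp
qed

text \<open>Here \<open>w n\<close> vanishes for every even n up to 8. From 10 on, the quadratic
  factor of \<open>3 ^ n\<close> is at least 1, and \<open>3 ^ n\<close> alone outweighs the
  negative term \<open>27 * real n ^ 2\<close>.\<close>

lemma hyperbolic_ineq_lower: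
  fixes x :: real
  assumes "0 < x"
  shows "29 / 2 * x * sinh (3 * x) + 27 / 2 * x * sinh x + 27 * x\<^sup>2 * cosh x
    < 81 / 4 * (cosh (3 * x) - cosh x) + 3 * x\<^sup>2 * cosh (3 * x)"
proof -
  define w :: "nat \<Rightarrow> real" where
    "w n = (real n ^ 2 / 3 - 31 / 6 * real n + 81 / 4) * 3 ^ n - 81 / 4 + 27 / 2 * real n - 27 * real n ^ 2" for n
  let ?l = "81 / 4 * (cosh (3 * x) - cosh x) + 1 / 3 * ((3 * x)\<^sup>2 * cosh (3 * x))
      - (29 / 6 * (3 * x * sinh (3 * x)) + 27 / 2 * (x * sinh x) + 27 * (x\<^sup>2 * cosh x))"
  have sums: "(\<lambda>n. if even n then w n * (x ^ n / fact n) else 0) sums ?l"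
    by (rule sums_cong[THEN iffD1, rotated, OF sums_diff[OF sums_add[OF
            sums_mult[OF sums_diff[OF sums_even_cosh sums_even_cosh]]
            sums_mult[OF sums_even_square_mult_cosh]]
          sums_add[OF sums_add[OF sums_mult[OF sums_even_mult_sinh] sums_mult[OF sums_even_mult_sinh]]
            sums_mult[OF sums_even_square_mult_cosh]]]])
      (simp add: w_def power_mult_distrib power2_eq_square field_simps)
  have w_pos: "0 < w n" if "10 \<le> n" for n
  proof -
    have n: "10 \<le> real n"
      using that by simp
    have "1 \<le> real n ^ 2 / 3 - 31 / 6 * real n + 81 / 4"
    proof -
      \<comment> \<open>Divided by 3, this product is the quadratic with constant term 55/3 in place
        of 81/4; the surplus 23/12 exceeds 1.\<close>
      have "0 \<le> (real n - 10) * (real n - 11 / 2)"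
        using n by simp
      also have "\<dots> = real n ^ 2 - 31 / 2 * real n + 55"
        by (simp add: power2_eq_square field_simps)
      finally show ?thesis
        by simp
    qed
    then have "3 ^ n \<le> (real n ^ 2 / 3 - 31 / 6 * real n + 81 / 4) * 3 ^ n"
      by simp
    with three_power_ge[of n] that n show ?thesis
      unfolding w_def by linarith
  qed
  have w: "0 \<le> w n" if "even n" for n
  proof (cases "n < 10")
    case True
    then show ?thesis
      using even_less_10[OF that] by (auto simp: w_def)
  next
    case False
    then show ?thesis
      using w_pos[of n] by simp
  qed
  have "0 < ?l"
  proof (rule sums_pos[OF sums, where m = 10])
    show "0 \<le> (if even n then w n * (x ^ n / fact n) else 0)" for n
      using w \<open>0 < x\<close> by simp
    show "0 < (if even (10::nat) then w 10 * (x ^ 10 / fact 10) else 0)"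
      using \<open>0 < x\<close> w_pos[of 10] by (simp del: of_nat_numeral)
  qed
  then show ?thesis
    by (simp add: power2_eq_square algebra_simps)
qed

section \<open>Monotonicity of the logarithmic means\<close>

text \<open>\<open>J k q v\<close> is the logarithm of \<open>H k q b a / a\<close> at \<open>v = ln (b / a)\<close>. The three branches of \<open>H\<close>
  share the derivative \<open>1 / (3 * wt k q v)\<close>.\<close>

definition wt :: "real \<Rightarrow> real \<Rightarrow> real \<Rightarrow> real" where
  "wt k q v = (1 - k / 3) * exp (- q * v) + k / 3"

definition J :: "real \<Rightarrow> real \<Rightarrow> real \<Rightarrow> real" where
  "J k q v =
    (if q = 0 then v / 3
     else if k = 0 then (exp (q * v) - 1) / (3 * q)
     else ln (1 - k / 3 + k / 3 * exp (q * v)) / (k * q))"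

lemma wt_pos: "0 \<le> k \<Longrightarrow> k < 3 \<Longrightarrow> 0 < wt k q v"
  unfolding wt_def by (intro add_pos_nonneg mult_pos_pos) auto

lemma J_zero: "J k q 0 = 0"
  by (simp add: J_def)

lemma DERIV_J:
  assumes "0 \<le> k" "k < 3"
  shows "(J k q has_real_derivative 1 / (3 * wt k q v)) (at v)"
proof -
  consider "q = 0" | "q \<noteq> 0" "k = 0" | "q \<noteq> 0" "k \<noteq> 0" by blast
  then show ?thesis
  proof cases
    case 1
    then have J: "J k q = (\<lambda>v. v / 3)"
      by (auto simp: J_def)
    show ?thesis
      unfolding J using 1 by (auto intro!: derivative_eq_intros simp: wt_def)
  next
    case 2
    then have J: "J k q = (\<lambda>v. (exp (q * v) - 1) / (3 * q))"
      by (auto simp: J_def)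
    show ?thesis
      unfolding J using 2 by (auto intro!: derivative_eq_intros simp: wt_def exp_minus field_simps)
  next
    case 3
    then have J: "J k q = (\<lambda>v. ln (1 - k / 3 + k / 3 * exp (q * v)) / (k * q))"
      by (auto simp: J_def)
    have pos: "0 < 1 - k / 3 + k / 3 * exp (q * v)"
      using assms by (intro add_pos_nonneg) auto
    have eq: "1 - k / 3 + k / 3 * exp (q * v) = wt k q v * exp (q * v)"
      by (simp add: wt_def exp_minus field_simps)
    have "(J k q has_real_derivative
        (k / 3 * (exp (q * v) * q) / (1 - k / 3 + k / 3 * exp (q * v))) / (k * q)) (at v)"
      unfolding J using 3 pos by (auto intro!: derivative_eq_intros)
    moreover have "(k / 3 * (exp (q * v) * q) / (1 - k / 3 + k / 3 * exp (q * v))) / (k * q)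
        = 1 / (3 * wt k q v)"
      unfolding eq using 3 by (simp add: field_simps)
    ultimately show ?thesis
      by simp
  qed
qed

lemma DERIV_wt: "(wt k q has_real_derivative - q * (1 - k / 3) * exp (- q * v)) (at v)"
  unfolding wt_def by (auto intro!: derivative_eq_intros)

text \<open>Both functions vanish at 0 and their derivatives are reciprocals of
  \<open>3 * wt\<close>, which reverses the order of the weights.\<close>

lemma J_le_of_wt_le:
  assumes "0 \<le> k" "k < 3" "0 \<le> k'" "k' < 3" "0 \<le> v"
    and wt: "\<And>u. 0 \<le> u \<Longrightarrow> wt k' q' u \<le> wt k q u"
  shows "J k q v \<le> J k' q' v"
proof -
  have "J k' q' 0 - J k q 0 \<le> J k' q' v - J k q v"
  proof (rule DERIV_nonneg_imp_nondecreasing[OF \<open>0 \<le> v\<close>])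
    fix u :: real
    assume u: "0 \<le> u"
    have "((\<lambda>v. J k' q' v - J k q v) has_real_derivative
        1 / (3 * wt k' q' u) - 1 / (3 * wt k q u)) (at u)"
      using assms by (intro DERIV_diff DERIV_J)
    moreover have "0 \<le> 1 / (3 * wt k' q' u) - 1 / (3 * wt k q u)"
      using wt[OF u] wt_pos[of k' q' u] assms by (simp add: frac_le)
    ultimately show "\<exists>y. ((\<lambda>v. J k' q' v - J k q v) has_real_derivative y) (at u) \<and> 0 \<le> y"
      by blast
  qed
  then show ?thesis
    by (simp add: J_zero)
qed

lemma J_mono:
  assumes "0 \<le> k" "k < 3" "0 \<le> v" "q \<le> q'"
  shows "J k q v \<le> J k q' v"
  using assms by (intro J_le_of_wt_le) (auto simp: wt_def intro!: mult_left_mono mult_right_mono)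

text \<open>On the critical curve \<open>q * (1 - k / 3)\<close> is constantly 8/15, so the weights
  have equal slope at 0. A larger \<open>k\<close> gives a larger \<open>q\<close>, hence a faster
  decaying slope and a larger weight.\<close>

lemma J_critical_antimono:
  assumes "0 \<le> k" "k \<le> k'" "k' < 3" "0 \<le> v"
  shows "J k' (8 / (5 * (3 - k'))) v \<le> J k (8 / (5 * (3 - k))) v"
proof (rule J_le_of_wt_le)
  fix u :: real
  assume "0 \<le> u"
  define q q' where "q = 8 / (5 * (3 - k))" and "q' = 8 / (5 * (3 - k'))"
  have "q \<le> q'"
    unfolding q_def q'_def using assms by (intro divide_left_mono) auto
  have q: "q * (1 - k / 3) = 8 / 15" "q' * (1 - k' / 3) = 8 / 15"
    using assms by (simp_all add: q_def q'_def field_simps)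
  have "wt k' q' 0 - wt k q 0 \<le> wt k' q' u - wt k q u"
  proof (rule DERIV_nonneg_imp_nondecreasing[OF \<open>0 \<le> u\<close>])
    fix t :: real
    assume "0 \<le> t"
    have "((\<lambda>t. wt k' q' t - wt k q t) has_real_derivative
        8 / 15 * (exp (- q * t) - exp (- q' * t))) (at t)"
      by (rule DERIV_cong[OF DERIV_diff[OF DERIV_wt DERIV_wt]])
        (simp only: q minus_mult_left[symmetric], simp add: algebra_simps)
    moreover have "0 \<le> 8 / 15 * (exp (- q * t) - exp (- q' * t))"
      using \<open>q \<le> q'\<close> \<open>0 \<le> t\<close> by (simp add: mult_right_mono)
    ultimately show "\<exists>y. ((\<lambda>t. wt k' q' t - wt k q t) has_real_derivative y) (at t) \<and> 0 \<le> y"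
      by blast
  qed
  then show "wt k q u \<le> wt k' q' u"
    by (simp add: wt_def)
qed (use assms in auto)

text \<open>All weights equal 1 at 0 and have slope \<open>- q * (3 - k) / 3\<close> there. Were the
  conclusion false, \<open>wt k q\<close> would be the smaller weight just to the right of 0, making
  \<open>J k q\<close> the larger function there.\<close>

lemma J_le_imp:
  assumes k: "0 \<le> k" "k < 3" "0 \<le> k'" "k' < 3"
    and le: "\<And>v. 0 < v \<Longrightarrow> J k q v \<le> J k' q' v"
  shows "q * (3 - k) \<le> q' * (3 - k')"
proof (rule ccontr)
  assume contr: "\<not> ?thesis"
  have "((\<lambda>t. wt k q t - wt k' q' t) has_real_derivative
      - q * (1 - k / 3) - - q' * (1 - k' / 3)) (at 0)"
    by (rule DERIV_cong[OF DERIV_diff[OF DERIV_wt DERIV_wt]]) simp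
  then obtain d where d: "0 < d" "\<And>h. 0 < h \<Longrightarrow> h < d \<Longrightarrow> wt k q h < wt k' q' h"
    using DERIV_neg_dec_right[of "\<lambda>t. wt k q t - wt k' q' t" _ 0] contr
    by (fastforce simp: wt_def field_simps)
  have "J k q 0 - J k' q' 0 < J k q (d / 2) - J k' q' (d / 2)"
  proof (rule DERIV_pos_imp_increasing_open[where f = "\<lambda>v. J k q v - J k' q' v"])
    show "0 < d / 2"
      using d by simp
    have der: "((\<lambda>v. J k q v - J k' q' v) has_real_derivative
        1 / (3 * wt k q u) - 1 / (3 * wt k' q' u)) (at u)" for u
      using k by (intro DERIV_diff DERIV_J)
    show "\<exists>y. ((\<lambda>v. J k q v - J k' q' v) has_real_derivative y) (at u) \<and> 0 < y"
      if "0 < u" "u < d / 2" for u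
    proof (intro exI conjI)
      show "0 < 1 / (3 * wt k q u) - 1 / (3 * wt k' q' u)"
        using d(2)[of u] that wt_pos[of k q u] k by (simp add: frac_less2)
    qed (rule der)
    show "continuous_on {0..d / 2} (\<lambda>v. J k q v - J k' q' v)"
      by (intro continuous_at_imp_continuous_on ballI DERIV_isCont[OF der])
  qed
  with le[of "d / 2"] d show False
    by (simp add: J_zero)
qed

section \<open>Reduction of the means to one variable\<close>

lemma H_eq_exp_J:
  assumes "0 < a" "a < b" "0 \<le> k" "k < 3"
  shows "H k q b a = a * exp (J k q (ln (b / a)))"
proof -
  have t: "0 < b / a"
    using assms by simp
  consider "q = 0" | "q \<noteq> 0" "k = 0" | "q \<noteq> 0" "k \<noteq> 0" by blast
  then show ?thesis
  proof cases
    case 3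
    let ?m = "1 - k / 3 + k / 3 * exp (q * ln (b / a))"
    have m: "0 < ?m"
      using assms by (intro add_pos_nonneg) auto
    have "(1 - k / 3) * a powr q + k / 3 * b powr q = a powr q * ?m"
      using assms by (simp add: powr_def ln_div exp_diff algebra_simps)
    then have "H k q b a = (a powr q * ?m) powr (1 / (k * q)) * a powr (1 - 1 / k)"
      using 3 by (simp add: H_def)
    also have "\<dots> = a powr (1 / k) * ?m powr (1 / (k * q)) * a powr (1 - 1 / k)"
      using 3 m assms by (simp add: powr_mult powr_powr)
    \<comment> \<open>The two exponents of \<open>a\<close> add up to 1, so the mean is homogeneous
      of degree 1 in this branch too.\<close>
    also have "\<dots> = a powr (1 / k + (1 - 1 / k)) * ?m powr (1 / (k * q))"
      unfolding powr_add by simp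
    also have "\<dots> = a * exp (J k q (ln (b / a)))"
      using 3 m assms by (simp add: J_def powr_def)
    finally show ?thesis .
  qed (use t in \<open>auto simp: H_def J_def powr_def\<close>)
qed

lemma SB_eq_exp:
  assumes "0 < a" "0 < x"
  shows "SB (a * cosh x) a = a * exp (ln (sinh x) - ln x)"
proof -
  have "(a * cosh x)\<^sup>2 - a\<^sup>2 = (a * sinh x)\<^sup>2"
    using hyperbolic_pythagoras[of x] by algebra
  then show ?thesis
    using assms by (simp add: SB_def arcosh_cosh_real exp_diff real_sqrt_mult)
qed

lemma ex_cosh:
  assumes "0 < a" "a < (b::real)"
  obtains x where "0 < x" "b = a * cosh x"
  using that[of "arcosh (b / a)"] assms by auto

lemma all_pairs_iff:
  assumes "0 \<le> k" "k < 3"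
  shows "(\<forall>a b. 0 < a \<and> a < b \<longrightarrow> H k q b a < SB b a) \<longleftrightarrow>
      (\<forall>x>0. J k q (ln (cosh x)) < ln (sinh x) - ln x)" (is "?A \<longleftrightarrow> ?B")
    and "(\<forall>a b. 0 < a \<and> a < b \<longrightarrow> SB b a < H k q b a) \<longleftrightarrow>
      (\<forall>x>0. ln (sinh x) - ln x < J k q (ln (cosh x)))" (is "?C \<longleftrightarrow> ?D")
proof -
  have H: "H k q (a * cosh x) a = a * exp (J k q (ln (cosh x)))" if "0 < a" "0 < x" for a x :: real
    using that assms cosh_real_strict_mono[of 0 x] by (subst H_eq_exp_J) auto
  have c: "1 < cosh x" if "0 < x" for x :: real
    using cosh_real_strict_mono[of 0 x] that by simp
  show "?A \<longleftrightarrow> ?B"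
  proof safe
    fix x :: real assume ?A "0 < x"
    \<comment> \<open>By homogeneity the case a = 1 is enough; the factor 1 is kept so that the
      rules for \<open>a * cosh x\<close> match.\<close>
    then have "H k q (1 * cosh x) 1 < SB (1 * cosh x) 1"
      using c[of x] by simp
    then show "J k q (ln (cosh x)) < ln (sinh x) - ln x"
      using \<open>0 < x\<close> by (subst (asm) H, simp, simp, subst (asm) SB_eq_exp) auto
  next
    fix a b :: real assume B: ?B and ab: "0 < a" "a < b"
    then obtain x where "0 < x" "b = a * cosh x"
      by (blast elim: ex_cosh)
    with B ab show "H k q b a < SB b a"
      by (simp add: H SB_eq_exp)
  qed
  show "?C \<longleftrightarrow> ?D"
  proof safe
    fix x :: real assume ?C "0 < x"
    then have "SB (1 * cosh x) 1 < H k q (1 * cosh x) 1"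
      using c[of x] by simp
    then show "ln (sinh x) - ln x < J k q (ln (cosh x))"
      using \<open>0 < x\<close> by (subst (asm) H, simp, simp, subst (asm) SB_eq_exp) auto
  next
    fix a b :: real assume B: ?D and ab: "0 < a" "a < b"
    then obtain x where "0 < x" "b = a * cosh x"
      by (blast elim: ex_cosh)
    with B ab show "SB b a < H k q b a"
      by (simp add: H SB_eq_exp)
  qed
qed

section \<open>The sign of the derivative of the logarithmic quotient\<close>

text \<open>The derivative of \<open>ln (sinh x / x) - J k q (ln (cosh x))\<close> is a positive multiple of
  \<open>3 - k - R k q x\<close>. Working with the quotient \<open>R\<close> instead of its logarithm avoids having to
  locate where its numerator is positive.\<close>

definition den :: "real \<Rightarrow> real" where
  "den x = x * cosh x - sinh x"

definition R :: "real \<Rightarrow> real \<Rightarrow> real \<Rightarrow> real" where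
  "R k q x = cosh x powr (q - 1) * (x * (sinh x)\<^sup>2 - k * cosh x * den x) / den x"

lemma den_pos:
  assumes "0 < x"
  shows "0 < den x"
proof (rule gt_right_limit[where f = den and f' = "\<lambda>x. x * sinh x"])
  show "(den \<longlongrightarrow> 0) (at_right 0)"
    unfolding den_def by real_asymp
  show "(den has_real_derivative x * sinh x) (at x)" for x
    unfolding den_def by (auto intro!: derivative_eq_intros)
qed (use assms in auto)

text \<open>To leading order \<open>den x\<close> is x^3/3 and \<open>x * (sinh x)\<^sup>2\<close>
  is x^3.\<close>

lemma R_tendsto: "(R k q \<longlongrightarrow> 3 - k) (at_right 0)"
  unfolding R_def den_def by real_asymp

text \<open>The factor in front of the bracket is positive. The bracket is a polynomial in
  \<open>x\<close>, \<open>sinh x\<close> and \<open>cosh x\<close>, and its sign decides the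
  monotonicity of \<open>R\<close>.\<close>

lemma DERIV_R:
  assumes "0 < x"
  shows "(R k q has_real_derivative cosh x powr (q - 2) * sinh x / (den x)\<^sup>2 *
    ((q - 1) * (x * (sinh x)\<^sup>2 - k * cosh x * den x) * den x
     + cosh x * den x * ((1 + k) * sinh x + 2 * (1 - k) * x * cosh x)
     - cosh x * x * (x * (sinh x)\<^sup>2 - k * cosh x * den x))) (at x)"
proof -
  define B where "B = (\<lambda>x. x * (sinh x)\<^sup>2 - k * cosh x * den x)"
  have den: "(den has_real_derivative x * sinh x) (at x)"
    unfolding den_def by (auto intro!: derivative_eq_intros)
  have B: "(B has_real_derivative sinh x * ((1 + k) * sinh x + 2 * (1 - k) * x * cosh x)) (at x)"
    unfolding B_def
    by (auto intro!: derivative_eq_intros den simp: den_def power2_eq_square algebra_simps)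
  have c: "((\<lambda>x. cosh x powr (q - 1)) has_real_derivative (q - 1) * cosh x powr (q - 2) * sinh x) (at x)"
    by (auto intro!: derivative_eq_intros)
  have powr: "cosh x powr (q - 1) = cosh x powr (q - 2) * cosh x"
    using powr_add[of "cosh x" "q - 2" 1] by simp
  have R: "R k q = (\<lambda>x. cosh x powr (q - 1) * B x / den x)"
    by (simp add: R_def B_def fun_eq_iff)
  show ?thesis
    unfolding R fun_cong[OF B_def, symmetric]
    by (rule DERIV_cong[OF DERIV_divide[OF DERIV_mult[OF c B] den]])
      (use den_pos[OF assms] in \<open>simp_all add: powr divide_simps, simp add: power2_eq_square algebra_simps\<close>)
qed

text \<open>The numerator of the derivative contains
  \<open>3 * cosh x * wt k q (ln (cosh x))\<close>, which equals
  \<open>(3 - k) * cosh x powr (1 - q) + k * cosh x\<close>. Isolating \<open>3 - k\<close> leaves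
  exactly \<open>R\<close>.\<close>

lemma DERIV_log_quotient:
  assumes "0 \<le> k" "k < 3" "0 < x"
  shows "((\<lambda>x. ln (sinh x) - ln x - J k q (ln (cosh x))) has_real_derivative
    cosh x powr (1 - q) * den x / (3 * x * sinh x * cosh x * wt k q (ln (cosh x))) * (3 - k - R k q x)) (at x)"
proof -
  let ?w = "wt k q (ln (cosh x))"
  have w: "3 * cosh x * ?w = (3 - k) * cosh x powr (1 - q) + k * cosh x"
    by (simp add: wt_def powr_def algebra_simps exp_diff exp_minus field_simps)
  have wpos: "0 < ?w"
    using assms by (simp add: wt_pos)
  have R: "cosh x powr (1 - q) * R k q x * den x = x * (sinh x)\<^sup>2 - k * cosh x * den x"
    using den_pos[OF assms(3)] powr_add[of "cosh x" "1 - q" "q - 1"] by (simp add: R_def mult.assoc[symmetric])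
  have "((\<lambda>x. ln (sinh x) - ln x - J k q (ln (cosh x))) has_real_derivative
      cosh x / sinh x - 1 / x - 1 / (3 * ?w) * (sinh x / cosh x)) (at x)"
    using assms
    by (auto intro!: derivative_eq_intros DERIV_chain2[OF DERIV_J])
  moreover have "cosh x / sinh x - 1 / x - 1 / (3 * ?w) * (sinh x / cosh x)
     = (den x * (3 * cosh x * ?w) - x * (sinh x)\<^sup>2) / (3 * x * sinh x * cosh x * ?w)"
    using assms wpos by (simp add: den_def field_simps power2_eq_square)
  moreover have "den x * (3 * cosh x * ?w) - x * (sinh x)\<^sup>2 = cosh x powr (1 - q) * den x * (3 - k - R k q x)"
    unfolding w using R by (simp add: algebra_simps)
  ultimately show ?thesis
    by simp
qed

lemma log_quotient_tendsto:
  assumes "0 \<le> k" "k < 3"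
  shows "((\<lambda>x. ln (sinh x) - ln x - J k q (ln (cosh x))) \<longlongrightarrow> 0) (at_right 0)"
proof -
  have "isCont (\<lambda>x. J k q (ln (cosh x))) 0"
    by (intro isCont_o2[where g = "J k q" and f = "\<lambda>x. ln (cosh x)"] DERIV_isCont[OF DERIV_J[OF assms]] continuous_intros) simp_all
  then have "((\<lambda>x. J k q (ln (cosh x))) \<longlongrightarrow> J k q (ln (cosh 0))) (at_right 0)"
    using filterlim_at_split isCont_def by blast
  then have J: "((\<lambda>x. J k q (ln (cosh x))) \<longlongrightarrow> 0) (at_right 0)"
    by (simp add: J_zero)
  have "((\<lambda>x::real. ln (sinh x) - ln x) \<longlongrightarrow> 0) (at_right 0)"
    by real_asymp
  from tendsto_diff[OF this J] show ?thesis
    by simp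
qed

section \<open>The two extremal inequalities\<close>

text \<open>Two monotonicity steps: \<open>R\<close> increases from its limit 2 at 0, so the
  logarithmic quotient decreases from its limit 0.\<close>

lemma log_less_J_1:
  assumes "0 < x"
  shows "ln (sinh x) - ln x < J 1 (4 / 5) (ln (cosh x))"
proof -
  have R: "3 - 1 < R 1 (4 / 5) x" if "0 < x" for x
  proof (rule gt_right_limit[OF R_tendsto DERIV_R])
    fix x :: real
    assume x: "0 < x"
    \<comment> \<open>The factor 5 clears the denominator of \<open>4 / 5 - 1\<close>; the
      triple-argument formulas turn the bracket into the combination known to be positive.\<close>
    have "5 * ((4 / 5 - 1) * (x * (sinh x)\<^sup>2 - 1 * cosh x * den x) * den x
       + cosh x * den x * ((1 + 1) * sinh x + 2 * (1 - 1) * x * cosh x)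
       - cosh x * x * (x * (sinh x)\<^sup>2 - 1 * cosh x * den x))
      = x * sinh (3 * x) + 6 * x\<^sup>2 * cosh x - 9 / 4 * (cosh (3 * x) - cosh x)" (is "5 * ?P = _")
      unfolding cosh_triple sinh_triple den_def using hyperbolic_pythagoras[of x] by algebra
    then have "0 < 5 * ?P"
      using hyperbolic_ineq_upper[OF x] by simp
    then have "0 < ?P"
      by (rule zero_less_mult_pos) simp
    then show "0 < cosh x powr (4 / 5 - 2) * sinh x / (den x)\<^sup>2 * ?P"
      using x den_pos[OF x] by simp
  qed (use that in auto)
  have "ln (sinh x) - ln x - J 1 (4 / 5) (ln (cosh x)) < 0"
  proof (rule lt_right_limit[OF log_quotient_tendsto DERIV_log_quotient])
    fix x :: real
    assume "0 < x"
    then show "cosh x powr (1 - 4 / 5) * den x / (3 * x * sinh x * cosh x * wt 1 (4 / 5) (ln (cosh x)))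
        * (3 - 1 - R 1 (4 / 5) x) < 0"
      using R[of x] den_pos[of x] wt_pos[of 1]
      by (intro mult_pos_neg divide_pos_pos mult_pos_pos) auto
  qed (use assms in auto)
  then show ?thesis
    by simp
qed

text \<open>The same two steps with reversed signs: \<open>R\<close> decreases from its limit, so
  the logarithmic quotient increases from 0.\<close>

lemma J_23_17_less_log:
  assumes "0 < x"
  shows "J (23 / 17) (34 / 35) (ln (cosh x)) < ln (sinh x) - ln x"
proof -
  have R: "R (23 / 17) (34 / 35) x < 3 - 23 / 17" if "0 < x" for x
  proof (rule lt_right_limit[OF R_tendsto DERIV_R])
    fix x :: real
    assume x: "0 < x"
    have "35 * - ((34 / 35 - 1) * (x * (sinh x)\<^sup>2 - 23 / 17 * cosh x * den x) * den x
       + cosh x * den x * ((1 + 23 / 17) * sinh x + 2 * (1 - 23 / 17) * x * cosh x)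
       - cosh x * x * (x * (sinh x)\<^sup>2 - 23 / 17 * cosh x * den x))
      = 81 / 4 * (cosh (3 * x) - cosh x) + 3 * x\<^sup>2 * cosh (3 * x)
        - (29 / 2 * x * sinh (3 * x) + 27 / 2 * x * sinh x + 27 * x\<^sup>2 * cosh x)" (is "35 * - ?P = _")
      unfolding cosh_triple sinh_triple den_def using hyperbolic_pythagoras[of x] by algebra
    then have "0 < 35 * - ?P"
      using hyperbolic_ineq_lower[OF x] by simp
    then have "0 < - ?P"
      by (rule zero_less_mult_pos) simp
    then have "?P < 0"
      by (simp only: neg_0_less_iff_less)
    then show "cosh x powr (34 / 35 - 2) * sinh x / (den x)\<^sup>2 * ?P < 0"
      using x den_pos[OF x] by (intro mult_pos_neg) auto
  qed (use that in auto)
  have "0 < ln (sinh x) - ln x - J (23 / 17) (34 / 35) (ln (cosh x))"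
  proof (rule gt_right_limit[OF log_quotient_tendsto DERIV_log_quotient])
    fix x :: real
    assume "0 < x"
    then show "0 < cosh x powr (1 - 34 / 35) * den x / (3 * x * sinh x * cosh x * wt (23 / 17) (34 / 35) (ln (cosh x)))
        * (3 - 23 / 17 - R (23 / 17) (34 / 35) x)"
      using R[of x] den_pos[of x] wt_pos[of "23 / 17"]
      by (intro divide_pos_pos mult_pos_pos) auto
  qed (use assms in auto)
  then show ?thesis
    by simp
qed

section \<open>Necessity at infinity and the final equivalences\<close>

lemma ln_cosh_surj:
  assumes "0 < (v::real)"
  obtains x where "0 < x" "v = ln (cosh x)"
  using that[of "arcosh (exp v)"] assms by auto

text \<open>For positive \<open>q\<close>, \<open>J 1 q v\<close> stays within
  \<open>ln 3 / q\<close> of \<open>v\<close>, whereas \<open>ln (sinh x / x)\<close> lies below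
  \<open>v - ln x\<close>, whose deficit is unbounded.\<close>

lemma nonpos_of_J_less_log:
  assumes k: "0 \<le> k" "k \<le> 1"
    and less: "\<And>x. 0 < x \<Longrightarrow> J k q (ln (cosh x)) < ln (sinh x) - ln x"
  shows "q \<le> 0"
proof (rule ccontr)
  assume "\<not> q \<le> 0"
  then have q: "0 < q" by simp
  \<comment> \<open>\<open>H 1 q\<close> is at least \<open>3 powr (- 1 / q)\<close> times \<open>b\<close>, while \<open>SB\<close> is less than \<open>b / x\<close>.\<close>
  define x where "x = exp (ln 3 / q)"
  define v where "v = ln (cosh x)"
  have x: "0 < x"
    by (simp add: x_def)
  \<comment> \<open>The choice of \<open>x\<close> makes \<open>ln x\<close> equal to
    \<open>ln 3 / q\<close>, the loss from dropping the constant 2/3 inside the logarithm of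
    \<open>J 1 q v\<close>.\<close>
  have "v - ln x = ln (1 / 3 * exp (q * v)) / q"
    using q unfolding ln_mult_pos[OF _ exp_gt_zero] by (simp add: x_def ln_div ln_mult field_simps)
  also have "\<dots> \<le> J 1 q v"
    using q by (simp add: J_def divide_right_mono add_pos_nonneg)
  \<comment> \<open>For positive \<open>q\<close> the weight grows with \<open>k\<close>, so k = 1
    is the worst case; the limiting branch k = 0 is covered as well.\<close>
  also have "\<dots> \<le> J k q v"
  proof (rule J_le_of_wt_le)
    fix u :: real
    assume "0 \<le> u"
    then have "0 \<le> (1 / 3 - k / 3) * (1 - exp (- q * u))"
      using k q by (intro mult_nonneg_nonneg) auto
    then show "wt k q u \<le> wt 1 q u"
      by (simp add: wt_def algebra_simps)
  qed (use k in \<open>auto simp: v_def cosh_real_ge_1\<close>)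
  also have "\<dots> < ln (sinh x) - ln x"
    unfolding v_def using x by (rule less)
  also have "\<dots> < v - ln x"
    unfolding v_def using x by (simp add: sinh_less_cosh_real)
  finally show False .
qed

theorem theorem8:
  fixes k q q1 q2 :: real
  assumes "0 \<le> k" and "k < 3"
  shows "(23 / 17 \<le> k \<longrightarrow>
           ((\<forall>a b. 0 < a \<and> a < b \<longrightarrow> SB b a > H k q b a) \<longleftrightarrow> q \<le> 8 / (5 * (3 - k))))
       \<and> (k \<le> 1 \<longrightarrow>
           ((\<forall>a b. 0 < a \<and> a < b \<longrightarrow> H k q1 b a < SB b a \<and> SB b a < H k q2 b a) \<longleftrightarrow>
            q1 \<le> 0 \<and> q2 \<ge> 8 / (5 * (3 - k))))"
proof -
  let ?q = "8 / (5 * (3 - k))"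
  have v: "0 \<le> ln (cosh x)" for x :: real
    by (simp add: cosh_real_ge_1)
  \<comment> \<open>Necessity needs no expansion of \<open>SB\<close>: it is squeezed through the two extremal cases.\<close>
  have q_le: "q \<le> ?q" if "\<And>x. 0 < x \<Longrightarrow> J k q (ln (cosh x)) < ln (sinh x) - ln x" for q
  proof -
    have "q * (3 - k) \<le> 4 / 5 * (3 - 1)"
    proof (rule J_le_imp)
      fix v :: real
      assume "0 < v"
      then obtain x where "0 < x" "v = ln (cosh x)"
        by (rule ln_cosh_surj)
      then show "J k q v \<le> J 1 (4 / 5) v"
        using that[of x] log_less_J_1[of x] by simp
    qed (use assms in auto)
    then show ?thesis
      using assms by (simp add: field_simps)
  qed
  have q_ge: "?q \<le> q" if "\<And>x. 0 < x \<Longrightarrow> ln (sinh x) - ln x < J k q (ln (cosh x))" for q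
  proof -
    \<comment> \<open>Both extremal pairs lie on the critical curve: 34/35 * 28/17 and 4/5 * 2 are
      both 8/5.\<close>
    have "34 / 35 * (3 - 23 / 17) \<le> q * (3 - k)"
    proof (rule J_le_imp)
      fix v :: real
      assume "0 < v"
      then obtain x where "0 < x" "v = ln (cosh x)"
        by (rule ln_cosh_surj)
      then show "J (23 / 17) (34 / 35) v \<le> J k q v"
        using that[of x] J_23_17_less_log[of x] by simp
    qed (use assms in auto)
    then show ?thesis
      using assms by (simp add: field_simps)
  qed
  have less: "J k q (ln (cosh x)) < ln (sinh x) - ln x" if "23 / 17 \<le> k" "q \<le> ?q" "0 < x" for q x
  proof -
    have "J k q (ln (cosh x)) \<le> J k ?q (ln (cosh x))"
      using assms that by (intro J_mono v)
    also have "\<dots> \<le> J (23 / 17) (34 / 35) (ln (cosh x))"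
      using J_critical_antimono[of "23 / 17" k, OF _ _ _ v] assms that by simp
    also have "\<dots> < ln (sinh x) - ln x"
      using that by (intro J_23_17_less_log)
    finally show ?thesis .
  qed
  have less_nonpos: "J k q (ln (cosh x)) < ln (sinh x) - ln x" if "q \<le> 0" "0 < x" for q x
  proof -
    have "J k q (ln (cosh x)) \<le> J k 0 (ln (cosh x))"
      using assms that by (intro J_mono v)
    \<comment> \<open>At q = 0 the mean is the same for every \<open>k\<close>, which allows the
      passage to 23/17, where the lower bound is available.\<close>
    also have "\<dots> = J (23 / 17) 0 (ln (cosh x))"
      by (simp add: J_def)
    also have "\<dots> \<le> J (23 / 17) (34 / 35) (ln (cosh x))"
      by (intro J_mono v) auto
    also have "\<dots> < ln (sinh x) - ln x"
      using that by (intro J_23_17_less_log)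
    finally show ?thesis .
  qed
  have greater: "ln (sinh x) - ln x < J k q (ln (cosh x))" if "k \<le> 1" "?q \<le> q" "0 < x" for q x
  proof -
    have "ln (sinh x) - ln x < J 1 (4 / 5) (ln (cosh x))"
      using that by (intro log_less_J_1)
    also have "\<dots> \<le> J k ?q (ln (cosh x))"
      using J_critical_antimono[of k 1, OF _ _ _ v] assms that by simp
    also have "\<dots> \<le> J k q (ln (cosh x))"
      using assms that by (intro J_mono v)
    finally show ?thesis .
  qed
  show ?thesis
  proof (intro conjI impI)
    assume k: "23 / 17 \<le> k"
    show "(\<forall>a b. 0 < a \<and> a < b \<longrightarrow> SB b a > H k q b a) \<longleftrightarrow> q \<le> ?q"
      unfolding all_pairs_iff[OF assms] using q_le less[OF k] by blast
  next
    assume k: "k \<le> 1"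
    have "(\<forall>a b. 0 < a \<and> a < b \<longrightarrow> H k q1 b a < SB b a \<and> SB b a < H k q2 b a) \<longleftrightarrow>
        (\<forall>x>0. J k q1 (ln (cosh x)) < ln (sinh x) - ln x) \<and> (\<forall>x>0. ln (sinh x) - ln x < J k q2 (ln (cosh x)))"
      unfolding all_pairs_iff[OF assms, symmetric] by blast
    also have "\<dots> \<longleftrightarrow> q1 \<le> 0 \<and> q2 \<ge> ?q"
      using nonpos_of_J_less_log[of k q1] less_nonpos[of q1] q_ge[of q2] greater[of q2] k assms by blast
    finally show "(\<forall>a b. 0 < a \<and> a < b \<longrightarrow> H k q1 b a < SB b a \<and> SB b a < H k q2 b a) \<longleftrightarrow>
        q1 \<le> 0 \<and> q2 \<ge> ?q" .
  qed
qed

end
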